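(* Let $G$ be a finite abelian group of exponent $e$, let $P$ be the set of prime divisors of $|G|$, and let $q$ be a prime power coprime to $|G|$. Then for all nonnegative integers $i_r$ ($r \in P$) such that $\prod_{r \in P} r^{i_r}$ divides $e$, $$\mathrm{ord}\Bigl(q \bmod \prod_{r \in P} r^{i_r}\Bigr) = \mathrm{lcm}\bigl\{\mathrm{ord}(q \bmod r^{i_r}) : r \in P\bigr\}.$$ Consequently, the degree of every irreducible representation of $G$ over the field $\mathbb{F}_q$ with $q$ elements is of the form $\mathrm{lcm}\{\mathrm{ord}(q \bmod r^{i_r}) : r \in P\}$ for some such nonnegative integers $i_r$. Moreover, for each $r \in P$ with $i_r \geq 1$, the $r'$-part of $\mathrm{ord}(q \bmod r^{i_r})$ is equal to $\mathrm{ord}(q \bmod r)$.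
   Context: For integers $q$ and $d \geq 1$ that are coprime, $\mathrm{ord}(q \bmod d)$ denotes the smallest positive integer $n$ such that $d$ divides $q^n - 1$; in particular $\mathrm{ord}(q \bmod 1) = 1$. The lcm of the empty set is $1$. The $r'$-part of a positive integer $m$, for a prime $r$, is the largest divisor of $m$ that is coprime to $r$. The degree of a representation over $\mathbb{F}_q$ is its dimension as an $\mathbb{F}_q$-vector space; irreducible means irreducible over $\mathbb{F}_q$. *)

theory Defs
  imports "HOL-Algebra.Coset" "HOL-Number_Theory.Number_Theory" "HOL-Library.Cardinality"
begin

definition group_exponent :: "('g, 'm) monoid_scheme \<Rightarrow> nat" where
  "group_exponent G =
     (LEAST n. 0 < n \<and> (\<forall>x \<in> carrier G. x [^]\<^bsub>G\<^esub> n = \<one>\<^bsub>G\<^esub>))"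

text \<open>The r'-part of \<open>m\<close>.\<close>

definition coprime_part :: "nat \<Rightarrow> nat \<Rightarrow> nat" where
  "coprime_part r m = Max {k. k dvd m \<and> coprime k r}"

text \<open>
  The argument order of \<^const>\<open>ord\<close> is modulus first: \<open>ord d q\<close> is the order of \<open>q\<close> modulo \<open>d\<close>.
\<close>

lemma ord_eq_Least:
  fixes d q :: nat
  assumes "coprime q d" and "q \<ge> 1"
  shows "ord d q = (LEAST n. 0 < n \<and> d dvd q ^ n - 1)"
proof -
  have "[q ^ n = 1] (mod d) \<longleftrightarrow> d dvd q ^ n - 1" for n
    using assms(2) by (simp add: cong_altdef_nat)
  moreover have "coprime d q"
    using assms(1) by (simp add: coprime_commute)
  ultimately show ?thesis
    by (simp add: ord_def)
qed

definition general_linear_group ::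
    "('k::field \<Rightarrow> 'v::ab_group_add \<Rightarrow> 'v) \<Rightarrow> ('v \<Rightarrow> 'v) monoid" where
  "general_linear_group scale =
     \<lparr>carrier = {f. Vector_Spaces.linear scale scale f \<and> bij f},
      monoid.mult = (\<circ>), one = id\<rparr>"

locale linear_representation = group G + vector_space scale
  for G :: "('g, 'm) monoid_scheme" (structure)
    and scale :: "'k::field \<Rightarrow> 'v::ab_group_add \<Rightarrow> 'v" +
  fixes \<rho> :: "'g \<Rightarrow> 'v \<Rightarrow> 'v"
  assumes rho_hom: "\<rho> \<in> hom G (general_linear_group scale)"

locale irreducible_representation = linear_representation G scale \<rho>
  for G :: "('g, 'm) monoid_scheme" (structure)
    and scale :: "'k::field \<Rightarrow> 'v::ab_group_add \<Rightarrow> 'v"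
    and \<rho> :: "'g \<Rightarrow> 'v \<Rightarrow> 'v" +
  assumes nonzero: "UNIV \<noteq> {0 :: 'v}"
    and irreducible:
      "\<lbrakk>subspace U; \<And>g. g \<in> carrier G \<Longrightarrow> \<rho> g ` U \<subseteq> U\<rbrakk> \<Longrightarrow> U = {0} \<or> U = UNIV"

text \<open>
  The library's \<open>dim\<close> is \<open>0\<close> for infinite-dimensional spaces; the nonzero space
  of an irreducible representation of a finite group is finite-dimensional.
\<close>

definition representation_degree :: "('k::field \<Rightarrow> 'v::ab_group_add \<Rightarrow> 'v) \<Rightarrow> nat" where
  "representation_degree scale = vector_space.dim scale UNIV"

end

theory Submission
  imports Defs
begin

text \<open>
  The first and third assertions are arithmetic. By the Chinese remainder theorem, the order of
  \<open>q\<close> modulo a product of pairwise coprime factors is the lcm of the orders modulo the factors.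
  Passing from the modulus \<open>r\<close> to \<open>r ^ k\<close> multiplies the order by a power of \<open>r\<close>, because
  \<open>x \<equiv> 1\<close> modulo \<open>r\<close> forces \<open>x ^ r ^ j \<equiv> 1\<close> modulo \<open>r ^ (j + 1)\<close>; as the order modulo \<open>r\<close>
  divides \<open>r - 1\<close>, it is what remains when the \<open>r\<close>-part is removed
  (\<open>coprime_part_ord_prime_power\<close>).

  The heart of the matter is the degree of an irreducible representation on \<open>V\<close>. By Schur's lemma
  the commutant of the image of \<open>G\<close> is a division algebra, and since \<open>G\<close> is abelian it contains
  the image itself. Hence evaluation at a fixed nonzero vector \<open>v\<close> is a bijection from the commutant
  onto \<open>V\<close>, the commutant is commutative, and \<open>V\<close> itself becomes a finite field with unit \<open>v\<close>,
  in which \<open>\<rho> g\<close> is multiplication by \<open>\<rho> g v\<close>. Let \<open>n\<close> be the degree, so that \<open>V\<close> has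
  \<open>q ^ n\<close> elements, and let \<open>d\<close> be the exponent of the group of all \<open>\<rho> g v\<close>.
  Lagrange's theorem gives \<open>d dvd q ^ n - 1\<close>, so \<open>m = ord d q\<close> divides \<open>n\<close>.
  Conversely, the map \<open>x \<mapsto> x ^ q ^ m\<close> is linear over the scalars (Frobenius) and fixes each
  \<open>\<rho> g v\<close>; these span \<open>V\<close>, so all \<open>q ^ n - 1\<close> nonzero elements are roots of
  \<open>X ^ (q ^ m - 1) - 1\<close>, which forces \<open>n \<le> m\<close>. Thus the degree is \<open>ord d q\<close>
  (\<open>representation_degree_eq_ord\<close>). Since \<open>d\<close> divides both the exponent and the order of \<open>G\<close>,
  factoring it into primes and using the first assertion gives the stated form.
\<close>

section \<open>Orders modulo prime powers\<close>

text \<open>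
  In \<open>x ^ r - 1 = (x - 1) * (1 + x + \<dots> + x ^ (r - 1))\<close> the second factor is congruent to
  \<open>r\<close> modulo \<open>r\<close> and therefore contributes one more factor \<open>r\<close>.
\<close>

lemma cong_one_prime_power_lift:
  fixes r x :: nat
  assumes "[x = 1] (mod r ^ Suc j)" 
  shows "[x ^ r = 1] (mod r ^ Suc (Suc j))"
proof -
  have x: "[int x = 1] (mod int r ^ Suc j)"
    using assms by (metis cong_int_iff of_nat_1 of_nat_power)
  have "int x ^ r - 1 = (int x - 1) * (\<Sum>i<r. int x ^ i)"
    by (simp add: power_diff_1_eq)
  moreover have "int r ^ Suc j dvd int x - 1"
    using x by (simp add: cong_iff_dvd_diff)
  moreover have "int r dvd (\<Sum>i<r. int x ^ i)"
  proof -
    have "[int x = 1] (mod int r)"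
      using x by (rule cong_dvd_modulus) simp
    hence "[(\<Sum>i<r. int x ^ i) = (\<Sum>i<r. 1 ^ i)] (mod int r)"
      by (intro cong_sum cong_pow)
    thus ?thesis
      by (simp add: cong_dvd_iff)
  qed
  ultimately have "int r ^ Suc j * int r dvd int x ^ r - 1"
    by (simp only: mult_dvd_mono)
  hence "[int (x ^ r) = int 1] (mod int (r ^ Suc (Suc j)))"
    by (simp add: cong_iff_dvd_diff mult_ac)
  thus ?thesis
    by (simp only: cong_int_iff)
qed

lemma cong_one_power_prime_power:
  fixes r x :: nat
  assumes "[x = 1] (mod r)"
  shows "[x ^ (r ^ j) = 1] (mod r ^ Suc j)"
proof (induction j)
  case (Suc j)
  from cong_one_prime_power_lift[OF this] show ?case
    by (simp add: power_mult mult.commute flip: power_mult)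
qed (use assms in simp)

text \<open>
  The order modulo \<open>r ^ k\<close> lies, with respect to divisibility, between \<open>ord r q\<close> and
  \<open>ord r q * r ^ (k - 1)\<close>, and \<open>ord r q\<close> is coprime to \<open>r\<close> as a divisor of \<open>r - 1\<close>.
\<close>

lemma coprime_part_ord_prime_power:
  fixes q r k :: nat
  assumes r: "prime r" and qr: "coprime q r" and k: "k \<ge> 1"
  shows "coprime_part r (ord (r ^ k) q) = ord r q"
proof -
  obtain j where j: "k = Suc j" using k by (cases k) auto
  have "[(q ^ ord r q) ^ (r ^ j) = 1] (mod r ^ k)"
    unfolding j by (rule cong_one_power_prime_power) (rule ord)
  hence upper: "ord (r ^ k) q dvd ord r q * r ^ j"
    by (simp add: ord_divides' flip: power_mult)
  have lower: "ord r q dvd ord (r ^ k) q"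
    unfolding ord_divides[symmetric]
    by (rule cong_dvd_modulus_nat[OF ord]) (use k in simp)
  have "ord r q dvd totient r"
    using qr by (intro order_divides_totient) (simp add: coprime_commute)
  hence cop: "coprime (ord r q) r"
    using r by (metis coprime_commute coprime_divisors dvd_refl totient_prime prime_gt_0_nat coprime_diff_one_left_nat)
  have "{m. m dvd ord (r ^ k) q \<and> coprime m r} = {m. m dvd ord r q}"
  proof (intro equalityI subsetI CollectI; elim CollectE conjE)
    fix m assume m: "m dvd ord (r ^ k) q" "coprime m r"
    have "m dvd ord r q * r ^ j" using m(1) upper by (rule dvd_trans)
    moreover have "coprime m (r ^ j)" using m(2) by simp
    ultimately show "m dvd ord r q" by (simp add: coprime_dvd_mult_left_iff)
  next
    fix m assume m: "m dvd ord r q"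
    show "m dvd ord (r ^ k) q \<and> coprime m r"
      using m lower cop by (metis dvd_trans coprime_divisors dvd_refl)
  qed
  moreover have "ord r q > 0" using qr by (simp add: coprime_commute)
  ultimately show ?thesis
    unfolding coprime_part_def by simp
qed
section \<open>Finite fields and vector spaces over them\<close>

text \<open>
  This is Lagrange's theorem in the multiplicative group. The finiteness of the type is a
  hypothesis here, not a type class, because in the application it follows from the cardinality \<open>q\<close>.
\<close>

lemma finite_field_power_card:
  fixes c :: "'k::field"
  assumes "finite (UNIV :: 'k set)"
  shows "c ^ CARD('k) = c"
proof (cases "c = 0")
  case False
  define M where "M = \<lparr>carrier = UNIV - {0 :: 'k}, monoid.mult = (*), one = 1 :: 'k\<rparr>"
  interpret M: comm_group M
    by (rule comm_groupI) (auto simp: M_def mult_ac intro!: bexI[of _ "inverse x" for x])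
  have pow: "x [^]\<^bsub>M\<^esub> n = x ^ n" for x and n :: nat
    by (induction n) (simp_all add: nat_pow_def M_def mult.commute)
  have "c ^ card (UNIV - {0 :: 'k}) = 1"
    using M.power_order_eq_one[of c] assms False unfolding pow by (simp add: M_def)
  hence "c ^ (CARD('k) - 1) = 1"
    using assms by (simp add: card_Diff_singleton)
  moreover have "Suc (CARD('k) - 1) = CARD('k)"
    using assms finite_UNIV_card_ge_0 by (intro Suc_diff_1) blast
  ultimately show ?thesis
    using power_Suc[of c "CARD('k) - 1"] by simp
next
  case True
  have "CARD('k) \<noteq> 0"
    using assms by simp
  thus ?thesis
    using True by (simp only: power_0_left if_False)
qed

lemma (in vector_space) card_eq_card_scalars_power_dim:
  assumes "finite S" and "span S = UNIV"
  shows "card (UNIV :: 'b set) = CARD('a) ^ dim UNIV"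
proof -
  obtain B where B: "independent B" "UNIV \<subseteq> span B" "card B = dim UNIV"
    by (rule basis_exists[of UNIV])
  have fin: "finite B"
    using independent_span_bound[of S B] B(1) assms by simp
  let ?f = "\<lambda>c :: 'b \<Rightarrow> 'a. \<Sum>b\<in>B. scale (c b) b"
  have "inj_on ?f (B \<rightarrow>\<^sub>E UNIV)"
  proof (rule inj_onI)
    fix c c' assume c: "c \<in> B \<rightarrow>\<^sub>E UNIV" "c' \<in> B \<rightarrow>\<^sub>E UNIV" and eq: "?f c = ?f c'"
    have "(\<Sum>b\<in>B. scale (c b - c' b) b) = 0"
      using eq by (simp add: scale_left_diff_distrib sum_subtractf)
    hence "c b - c' b = 0" if "b \<in> B" for b
      using independentD[OF B(1) fin subset_refl _ that, of "\<lambda>b. c b - c' b"] by simp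
    thus "c = c'"
      using c by (auto intro: PiE_ext)
  qed
  moreover have "?f ` (B \<rightarrow>\<^sub>E UNIV) = UNIV"
  proof (intro equalityI subsetI)
    fix w :: 'b
    have "w \<in> span B"
      using B(2) by (rule subsetD) simp
    then obtain c where c: "w = ?f c"
      unfolding span_finite[OF fin] by (rule rangeE)
    have "w = ?f (restrict c B)"
      unfolding c by (intro sum.cong) auto
    thus "w \<in> ?f ` (B \<rightarrow>\<^sub>E UNIV)"
      by (rule image_eqI[where f = ?f]) (simp only: restrict_PiE_iff, simp)
  qed (rule UNIV_I)
  ultimately have "card (UNIV :: 'b set) = card (B \<rightarrow>\<^sub>E (UNIV :: 'a set))"
    using card_image by fastforce
  also have "\<dots> = CARD('a) ^ card B"
    by (simp add: card_PiE fin)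
  finally show ?thesis
    using B(3) by simp
qed

section \<open>An irreducible representation of an abelian group as a field\<close>

text \<open>
  The choice of the nonzero vector \<open>v\<close> identifies the commutant with the representation space:
  \<open>v\<close> plays the role of the unit element.
\<close>

locale abelian_irreducible_representation =
    irreducible_representation G scale \<rho> + comm_group G
  for G :: "('g, 'm) monoid_scheme" (structure)
    and scale :: "'k::field \<Rightarrow> 'v::ab_group_add \<Rightarrow> 'v"
    and \<rho> :: "'g \<Rightarrow> 'v \<Rightarrow> 'v" +
  fixes v :: 'v
  assumes v_nonzero: "v \<noteq> 0"
begin

lemma rho_add: "g \<in> carrier G \<Longrightarrow> \<rho> g (x + y) = \<rho> g x + \<rho> g y"
  and rho_scale: "g \<in> carrier G \<Longrightarrow> \<rho> g (scale c x) = scale c (\<rho> g x)"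
  using hom_in_carrier[OF rho_hom, of g]
  by (auto simp: general_linear_group_def Vector_Spaces.linear_iff)

lemma rho_mult: "g \<in> carrier G \<Longrightarrow> h \<in> carrier G \<Longrightarrow> \<rho> (g \<otimes> h) x = \<rho> g (\<rho> h x)"
  using hom_mult[OF rho_hom, of g h] by (simp add: general_linear_group_def)

lemma rho_one: "\<rho> \<one> x = x"
proof -
  have "bij (\<rho> \<one>)"
    using hom_in_carrier[OF rho_hom, of \<one>] by (simp add: general_linear_group_def)
  moreover have "\<rho> \<one> (\<rho> \<one> x) = \<rho> \<one> x"
    by (simp flip: rho_mult)
  ultimately show ?thesis
    by (simp add: bij_is_inj inj_eq)
qed

lemma rho_commute: "g \<in> carrier G \<Longrightarrow> h \<in> carrier G \<Longrightarrow> \<rho> g (\<rho> h x) = \<rho> h (\<rho> g x)"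
  by (metis m_comm rho_mult)

lemma invariant_subspace_eq_UNIV:
  assumes "subspace U" and "\<And>g x. g \<in> carrier G \<Longrightarrow> x \<in> U \<Longrightarrow> \<rho> g x \<in> U"
    and "x \<in> U" and "x \<noteq> 0"
  shows "U = UNIV"
  using irreducible[of U] assms by blast

text \<open>
  The span of the orbit of \<open>v\<close> is invariant and nonzero. In particular the space is
  spanned by finitely many vectors when \<open>G\<close> is finite.
\<close>

lemma span_orbit: "span ((\<lambda>g. \<rho> g v) ` carrier G) = UNIV"
proof (rule invariant_subspace_eq_UNIV)
  let ?S = "span ((\<lambda>g. \<rho> g v) ` carrier G)"
  show "subspace ?S" by simp
  show "v \<in> ?S"
    by (rule span_base) (metis image_eqI one_closed rho_one)
  fix g x
  assume g: "g \<in> carrier G" and x: "x \<in> ?S"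
  have "subspace {x. \<rho> g x \<in> ?S}"
    using g by (auto simp: subspace_def rho_add rho_scale span_add span_scale)
      (metis add_cancel_right_right rho_add span_zero)
  moreover have "(\<lambda>g. \<rho> g v) ` carrier G \<subseteq> {x. \<rho> g x \<in> ?S}"
    using g by (auto simp flip: rho_mult intro!: span_base)
  ultimately show "\<rho> g x \<in> ?S"
    using span_minimal x by blast
qed (rule v_nonzero)

definition commutant :: "('v \<Rightarrow> 'v) set" where
  "commutant = {f. Vector_Spaces.linear scale scale f \<and> (\<forall>g\<in>carrier G. \<forall>x. f (\<rho> g x) = \<rho> g (f x))}"

lemma commutant_iff:
  "f \<in> commutant \<longleftrightarrow> (\<forall>x y. f (x + y) = f x + f y) \<and> (\<forall>c x. f (scale c x) = scale c (f x))
     \<and> (\<forall>g\<in>carrier G. \<forall>x. f (\<rho> g x) = \<rho> g (f x))"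
  using vector_space_axioms by (auto simp: commutant_def Vector_Spaces.linear_iff)

lemma commutant_add: "f \<in> commutant \<Longrightarrow> f (x + y) = f x + f y"
  and commutant_scale: "f \<in> commutant \<Longrightarrow> f (scale c x) = scale c (f x)"
  and commutant_rho: "f \<in> commutant \<Longrightarrow> g \<in> carrier G \<Longrightarrow> f (\<rho> g x) = \<rho> g (f x)"
  by (simp_all add: commutant_iff)

lemma commutant_zero: "f \<in> commutant \<Longrightarrow> f 0 = 0"
  by (metis add_cancel_right_right commutant_add)

lemma id_in_commutant: "(\<lambda>x. x) \<in> commutant"
  and zero_in_commutant: "(\<lambda>x. 0) \<in> commutant"
  and comp_in_commutant: "f \<in> commutant \<Longrightarrow> h \<in> commutant \<Longrightarrow> (\<lambda>x. f (h x)) \<in> commutant"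
  and add_in_commutant: "f \<in> commutant \<Longrightarrow> h \<in> commutant \<Longrightarrow> (\<lambda>x. f x + h x) \<in> commutant"
  and scale_in_commutant: "f \<in> commutant \<Longrightarrow> (\<lambda>x. scale c (f x)) \<in> commutant"
  and rho_in_commutant: "g \<in> carrier G \<Longrightarrow> \<rho> g \<in> commutant"
proof -
  have "\<rho> g 0 = 0" if "g \<in> carrier G" for g
    by (metis add_cancel_right_right rho_add that)
  thus "(\<lambda>x. 0) \<in> commutant"
    by (simp add: commutant_iff)
qed (auto simp: commutant_iff rho_add rho_scale rho_commute scale_right_distrib add_ac mult.commute)

text \<open>
  Schur's lemma in the form needed here: the set on which two elements of the commutant agree is
  an invariant subspace, hence everything as soon as it is nonzero.
\<close>

lemma commutant_eqI:
  assumes f: "f \<in> commutant" and h: "h \<in> commutant" and "f x = h x" and "x \<noteq> 0"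
  shows "f = h"
proof -
  have "{x. f x = h x} = UNIV"
  proof (rule invariant_subspace_eq_UNIV)
    show "subspace {x. f x = h x}"
      using f h by (simp add: subspace_def commutant_zero commutant_add commutant_scale)
    show "\<rho> g y \<in> {x. f x = h x}" if "g \<in> carrier G" "y \<in> {x. f x = h x}" for g y
      using that f h by (simp add: commutant_rho)
  qed (use assms in auto)
  thus ?thesis by auto
qed

text \<open>
  The other half of Schur's lemma, applied to the range in place of the kernel.
\<close>

lemma commutant_surj:
  assumes f: "f \<in> commutant" and "f x \<noteq> 0"
  shows "surj f"
proof (rule invariant_subspace_eq_UNIV)
  show "subspace (range f)"
    unfolding subspace_def
    by (auto simp flip: commutant_add[OF f] commutant_scale[OF f])
      (metis commutant_zero f rangeI)
  show "\<rho> g y \<in> range f" if "g \<in> carrier G" "y \<in> range f" for g y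
    using that by (auto simp flip: commutant_rho[OF f])
qed (use assms in auto)

text \<open>
  Evaluation at \<open>v\<close> is onto: the values of the commutant at \<open>v\<close> form a subspace, which
  contains the orbit of \<open>v\<close> since \<open>G\<close> is abelian. The operators found in this way lie in the linear
  span of the image of \<open>G\<close>, so they commute with all of the commutant; carrying this along
  yields the commutativity of the commutant (\<open>endo_commute\<close>).
\<close>

lemma ex_commutant:
  "\<exists>f\<in>commutant. f v = w \<and> (\<forall>h\<in>commutant. \<forall>x. f (h x) = h (f x))"
proof -
  let ?S = "{w. \<exists>f\<in>commutant. f v = w \<and> (\<forall>h\<in>commutant. \<forall>x. f (h x) = h (f x))}"
  have "subspace ?S"
    unfolding subspace_def
  proof (intro conjI ballI allI)
    show "0 \<in> ?S"
      using zero_in_commutant by (auto simp: commutant_zero)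
  next
    fix x y assume "x \<in> ?S" "y \<in> ?S"
    then obtain f f' where f: "f \<in> commutant" "f v = x" "\<forall>h\<in>commutant. \<forall>x. f (h x) = h (f x)"
      and f': "f' \<in> commutant" "f' v = y" "\<forall>h\<in>commutant. \<forall>x. f' (h x) = h (f' x)"
      by blast
    thus "x + y \<in> ?S"
      by (auto intro!: bexI[OF _ add_in_commutant[OF f(1) f'(1)]] simp: commutant_add)
  next
    fix c x assume "x \<in> ?S"
    then obtain f where f: "f \<in> commutant" "f v = x" "\<forall>h\<in>commutant. \<forall>x. f (h x) = h (f x)"
      by blast
    thus "scale c x \<in> ?S"
      by (auto intro!: bexI[OF _ scale_in_commutant[OF f(1)]] simp: commutant_scale)
  qed
  moreover have "(\<lambda>g. \<rho> g v) ` carrier G \<subseteq> ?S"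
    using rho_in_commutant by (auto simp: commutant_rho)
  ultimately show ?thesis
    using span_minimal[of "(\<lambda>g. \<rho> g v) ` carrier G" ?S] span_orbit by auto
qed

text \<open>
  The inverse of evaluation at \<open>v\<close>. As \<open>endo\<close> has two arguments, it is at the same time
  the multiplication on the representation space that is transported from composition.
\<close>

definition endo :: "'v \<Rightarrow> 'v \<Rightarrow> 'v" where
  "endo w = (SOME f. f \<in> commutant \<and> f v = w)"

lemma endo_in_commutant: "endo w \<in> commutant" and endo_base: "endo w v = w"
  using someI_ex[of "\<lambda>f. f \<in> commutant \<and> f v = w"] ex_commutant[of w]
  by (auto simp: endo_def)

lemma endo_unique: "f \<in> commutant \<Longrightarrow> f v = w \<Longrightarrow> f = endo w"
  using commutant_eqI[OF _ endo_in_commutant _ v_nonzero, of f w] endo_base by simp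

lemma endo_add_left: "endo (x + y) z = endo x z + endo y z"
  and endo_scale_left: "endo (scale c x) z = scale c (endo x z)"
  and endo_assoc: "endo (endo x y) z = endo x (endo y z)"
  and endo_one: "endo v z = z"
  using endo_unique[OF add_in_commutant[OF endo_in_commutant endo_in_commutant], of x y "x + y"]
    endo_unique[OF scale_in_commutant[OF endo_in_commutant], of c x "scale c x"]
    endo_unique[OF comp_in_commutant[OF endo_in_commutant endo_in_commutant], of x y "endo x y"]
    endo_unique[OF id_in_commutant, of v]
  by (metis endo_base)+

lemma endo_add_right: "endo x (y + z) = endo x y + endo x z"
  by (rule commutant_add[OF endo_in_commutant])

lemma endo_commute: "endo x y = endo y x"
proof -
  obtain f where "f \<in> commutant" "f v = x" "\<forall>h\<in>commutant. \<forall>x. f (h x) = h (f x)"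
    using ex_commutant by blast
  hence "endo x (endo y v) = endo y (endo x v)"
    using endo_unique endo_in_commutant by metis
  thus ?thesis by (simp add: endo_base)
qed

lemma endo_rho: "g \<in> carrier G \<Longrightarrow> endo (\<rho> g v) = \<rho> g"
  using endo_unique[OF rho_in_commutant] by simp

lemma endo_inverse: "x \<noteq> 0 \<Longrightarrow> \<exists>y. endo x y = v"
  using commutant_surj[OF endo_in_commutant, of x v] endo_base by (metis surjD)

lemma endo_zero_left: "endo 0 x = 0"
  using endo_add_left[of 0 0 x] by simp

lemma endo_zero_right: "endo x 0 = 0"
  by (rule commutant_zero[OF endo_in_commutant])

definition V_field :: "'v ring" where
  "V_field = \<lparr>carrier = UNIV, monoid.mult = endo, one = v, ring.zero = 0, ring.add = (+)\<rparr>"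

lemma V_field_simps [simp]: "carrier V_field = UNIV" "x \<otimes>\<^bsub>V_field\<^esub> y = endo x y" "\<one>\<^bsub>V_field\<^esub> = v"
    "\<zero>\<^bsub>V_field\<^esub> = 0" "x \<oplus>\<^bsub>V_field\<^esub> y = x + y"
  by (simp_all add: V_field_def)

lemma V_field_is_field: "field V_field"
proof -
  interpret R: cring V_field
  proof (rule cringI)
    show "abelian_group V_field"
      by (rule abelian_groupI) (auto simp: add_ac intro: exI[of _ "- x" for x])
    show "comm_monoid V_field"
      by (rule comm_monoidI) (auto simp: endo_assoc endo_one intro: endo_commute)
  qed (simp add: endo_add_left)
  show ?thesis
    by (rule R.cring_fieldI2) (use v_nonzero endo_inverse in auto)
qed

lemma rho_pow: "g \<in> carrier G \<Longrightarrow> \<rho> g v [^]\<^bsub>V_field\<^esub> (n::nat) = \<rho> (g [^] n) v"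
proof (induction n)
  case 0
  thus ?case by (simp add: nat_pow_def rho_one)
next
  case (Suc n)
  have "\<rho> g v [^]\<^bsub>V_field\<^esub> Suc n = endo (\<rho> g v [^]\<^bsub>V_field\<^esub> n) (\<rho> g v)"
    by simp
  thus ?case using Suc endo_rho by (simp add: rho_mult)
qed

lemma scale_pow: "scale c x [^]\<^bsub>V_field\<^esub> (n::nat) = scale (c ^ n) (x [^]\<^bsub>V_field\<^esub> n)"
proof (induction n)
  case (Suc n)
  thus ?case
    by (simp add: endo_scale_left commutant_scale[OF endo_in_commutant] mult.commute)
qed simp

text \<open>
  The same structure in the form of a type class predicate, which gives access to the binomial
  expansion in characteristic \<open>p\<close>.
\<close>

lemma comm_semiring_endo: "class.comm_semiring_1 endo v (+) 0"
  by unfold_locales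
    (auto simp: endo_assoc endo_one endo_base endo_add_left endo_add_right endo_zero_left endo_zero_right v_nonzero add_ac
      intro: endo_commute)

section \<open>The degree as a multiplicative order\<close>

lemma frobenius_add:
  assumes prime: "prime CHAR('k)" and m: "m = CHAR('k) ^ a"
  shows "(x + y) [^]\<^bsub>V_field\<^esub> (m::nat) = x [^]\<^bsub>V_field\<^esub> m + y [^]\<^bsub>V_field\<^esub> m"
proof -
  interpret V: comm_semiring_1 endo v "(+)" 0
    by (rule comm_semiring_endo)
  have pow: "V.power z n = z [^]\<^bsub>V_field\<^esub> n" for z and n :: nat
    by (induction n) (simp_all add: nat_pow_def endo_commute)
  \<comment> \<open>The field on the representation space has the characteristic of the scalars.\<close>
  have "V.of_nat n = scale (of_nat n) v" for n
    by (induction n) (simp_all add: scale_left_distrib)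
  hence "V.of_nat n = 0 \<longleftrightarrow> of_nat n = (0 :: 'k)" for n
    using v_nonzero by simp
  hence "V.semiring_char TYPE('v) = CHAR('k)"
    by (simp add: V.semiring_char_def semiring_char_def)
  thus ?thesis
    using V.freshmans_dream'[of m a x y] prime m by (simp add: pow)
qed

text \<open>
  The elements fixed by a power of the Frobenius map form a subspace over the field of scalars;
  it is everything once it contains the orbit of \<open>v\<close>.
\<close>

lemma pow_card_scalars_power_eq:
  assumes fin: "finite (UNIV :: 'k set)" and "primepow (CARD('k))"
    and orbit: "\<And>g. g \<in> carrier G \<Longrightarrow> \<rho> g v [^]\<^bsub>V_field\<^esub> (CARD('k) ^ m) = \<rho> g v"
  shows "x [^]\<^bsub>V_field\<^esub> (CARD('k) ^ m) = x"
proof -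
  interpret R: field V_field by (rule V_field_is_field)
  let ?Q = "CARD('k) ^ m"
  obtain p a where p: "prime p" "CARD('k) = p ^ a"
    using assms(2) by (auto simp: primepow_def)
  have prime: "prime CHAR('k)"
    using fin by (intro prime_CHAR_semidom finite_imp_CHAR_pos)
  have "CHAR('k) dvd p ^ a"
    using CHAR_dvd_CARD[where ?'a = 'k] p(2) by simp
  hence "CHAR('k) = p"
    using prime p(1) by (metis prime_dvd_power primes_dvd_imp_eq)
  hence Q: "?Q = CHAR('k) ^ (a * m)"
    by (simp add: p(2) power_mult)
  have scalar: "c ^ ?Q = c" for c :: 'k
    by (induction m) (simp_all add: power_mult finite_field_power_card fin)
  have "subspace {x. x [^]\<^bsub>V_field\<^esub> ?Q = x}"
    unfolding subspace_def
    using frobenius_add[OF prime Q] R.nat_pow_zero[of ?Q] fin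
    by (auto simp: scale_pow scalar finite_UNIV_card_ge_0)
  thus ?thesis
    using span_minimal[of "(\<lambda>g. \<rho> g v) ` carrier G" "{x. x [^]\<^bsub>V_field\<^esub> ?Q = x}"] orbit span_orbit
    by auto
qed

lemma rho_base_nonzero: "g \<in> carrier G \<Longrightarrow> \<rho> g v \<noteq> 0"
  by (metis commutant_zero l_inv inv_closed rho_in_commutant rho_mult rho_one v_nonzero)

text \<open>
  The number \<open>d\<close> is the exponent of the image of \<open>G\<close>: by Schur's lemma \<open>\<rho> (g [^] n)\<close> fixes \<open>v\<close>
  only if it is the identity. The field on the representation space is used
  to read it off as the lcm of the orders of the elements \<open>\<rho> g v\<close>.
\<close>

lemma ex_image_exponent:
  "\<exists>d :: nat. \<forall>n. d dvd n \<longleftrightarrow> (\<forall>g\<in>carrier G. \<rho> (g [^] n) v = v)"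
proof -
  interpret R: field V_field by (rule V_field_is_field)
  interpret M: group "mult_of V_field" by (rule R.field_mult_group)
  have "M.ord (\<rho> g v) dvd n \<longleftrightarrow> \<rho> (g [^] n) v = v" if "g \<in> carrier G" for g n
    using M.pow_eq_id[of "\<rho> g v" n] rho_base_nonzero[OF that]
    by (simp add: nat_pow_mult_of rho_pow that)
  hence "\<forall>n. Lcm ((\<lambda>g. M.ord (\<rho> g v)) ` carrier G) dvd n \<longleftrightarrow> (\<forall>g\<in>carrier G. \<rho> (g [^] n) v = v)"
    by (simp add: Lcm_dvd_iff)
  thus ?thesis by blast
qed

text \<open>
  Lagrange's theorem in the multiplicative group bounds the order by the degree, and counting
  the roots of \<open>X ^ (q ^ m - 1) - 1\<close> gives the reverse bound. The qualified name
  \<open>Pocklington.ord\<close> denotes the order of \<open>q\<close> modulo \<open>d\<close>, as \<open>ord\<close> in this context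
  is the order of an element of \<open>G\<close>.
\<close>

lemma representation_degree_eq_ord:
  fixes d q :: nat
  assumes G: "finite (carrier G)" and card: "CARD('k) = q" and q: "primepow q"
    and d: "\<And>n. d dvd n \<longleftrightarrow> (\<forall>g\<in>carrier G. \<rho> (g [^] n) v = v)"
  shows "representation_degree scale = Pocklington.ord d q"
proof -
  interpret R: field V_field by (rule V_field_is_field)
  interpret M: group "mult_of V_field" by (rule R.field_mult_group)
  have q1: "q > 1"
    using primepow_gt_Suc_0[OF q] by simp
  have fin: "finite (UNIV :: 'k set)"
    using card q1 by (metis card.infinite not_one_less_zero)
  define n where "n = representation_degree scale"
  have cardV: "CARD('v) = q ^ n"
    using card_eq_card_scalars_power_dim[OF _ span_orbit] G card
    by (simp add: n_def representation_degree_def)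
  hence finV: "finite (UNIV :: 'v set)"
    using q1 by (metis card.infinite not_one_less_zero power_eq_0_iff)
  have ordM: "order (mult_of V_field) = q ^ n - 1"
    using finV cardV by (simp add: Coset.order_def card_Diff_singleton)
  have "card {0, v} \<le> CARD('v)"
    using finV by (intro card_mono) auto
  hence "n > 0"
    using v_nonzero cardV by (cases n) auto
  have pow: "\<rho> (g [^] k) v = v \<longleftrightarrow> \<rho> g v [^]\<^bsub>V_field\<^esub> k = v" if "g \<in> carrier G" for g and k :: nat
    using that by (simp add: rho_pow)
  have "d dvd q ^ n - 1"
    unfolding d using M.pow_order_eq_1 rho_base_nonzero
    by (auto simp: pow ordM nat_pow_mult_of)
  hence cong: "[q ^ n = 1] (mod d)"
    using q1 by (simp add: cong_altdef_nat)
  hence dvd: "Pocklington.ord d q dvd n"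
    by (simp only: ord_divides)
  define m where "m = Pocklington.ord d q"
  have "m > 0"
    using dvd \<open>n > 0\<close> by (auto simp: m_def intro: Nat.gr0I)
  have "[q ^ m = 1] (mod d)"
    unfolding m_def by (rule ord)
  hence "d dvd q ^ m - 1"
    using q1 by (simp add: cong_altdef_nat)
  hence "\<rho> g v [^]\<^bsub>V_field\<^esub> (q ^ m - 1) = v" if "g \<in> carrier G" for g
    using that unfolding d by (simp add: pow)
  hence orbit: "\<rho> g v [^]\<^bsub>V_field\<^esub> Suc (q ^ m - 1) = \<rho> g v" if "g \<in> carrier G" for g
    using that by (simp add: endo_one)
  have Suc: "Suc (q ^ m - 1) = q ^ m"
    using q1 by simp
  have fixed: "x [^]\<^bsub>V_field\<^esub> q ^ m = x" for x
    using pow_card_scalars_power_eq[OF fin, of m x] orbit q unfolding Suc by (simp add: card)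
  have "x [^]\<^bsub>V_field\<^esub> (q ^ m - 1) = v" if "x \<noteq> 0" for x
  proof -
    have "x [^]\<^bsub>V_field\<^esub> (q ^ m - 1) \<otimes>\<^bsub>V_field\<^esub> x = \<one>\<^bsub>V_field\<^esub> \<otimes>\<^bsub>V_field\<^esub> x"
      using fixed[of x] R.nat_pow_Suc[of x "q ^ m - 1"] unfolding Suc by (simp add: endo_one)
    thus ?thesis
      using R.m_rcancel[of x "x [^]\<^bsub>V_field\<^esub> (q ^ m - 1)" "\<one>\<^bsub>V_field\<^esub>"] that by simp
  qed
  hence "UNIV - {0} \<subseteq> {x \<in> carrier V_field. x [^]\<^bsub>V_field\<^esub> (q ^ m - 1) = \<one>\<^bsub>V_field\<^esub>}"
    by auto
  hence "card (UNIV - {0 :: 'v}) \<le> card {x \<in> carrier V_field. x [^]\<^bsub>V_field\<^esub> (q ^ m - 1) = \<one>\<^bsub>V_field\<^esub>}"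
    by (rule card_mono[OF finite_subset[OF subset_UNIV finV]])
  also have "\<dots> \<le> q ^ m - 1"
    using finV one_less_power[OF q1 \<open>m > 0\<close>] by (intro R.num_roots_le_deg) auto
  finally have "q ^ n - 1 \<le> q ^ m - 1"
    using finV cardV by (simp add: card_Diff_singleton)
  hence "q ^ n \<le> q ^ m"
    using Suc by linarith
  hence "n \<le> m"
    by (rule power_le_imp_le_exp[OF q1])
  moreover have "m \<le> n"
    using dvd \<open>n > 0\<close> by (auto simp: m_def dest: dvd_imp_le)
  ultimately show ?thesis
    by (simp add: n_def m_def)
qed

end

section \<open>The degrees of all irreducible representations\<close>

lemma (in group) pow_group_exponent:
  assumes "finite (carrier G)" and "x \<in> carrier G"
  shows "x [^] group_exponent G = \<one>"
proof -
  have "0 < Coset.order G \<and> (\<forall>x\<in>carrier G. x [^] Coset.order G = \<one>)"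
    using assms(1) by (simp add: pow_order_eq_1 order_gt_0_iff_finite)
  hence "\<forall>x\<in>carrier G. x [^] group_exponent G = \<one>"
    unfolding group_exponent_def by (rule LeastI2) blast
  thus ?thesis using assms(2) by blast
qed

theorem mainTheorem2:
  fixes G :: "('g, 'm) monoid_scheme" (structure)
    and q e :: nat
    and P :: "nat set"
  assumes "comm_group G" and "finite (carrier G)"
    and "e = group_exponent G"
    and "P = {r. Factorial_Ring.prime r \<and> r dvd Coset.order G}"
    and "primepow q" and "coprime q (Coset.order G)"
  shows
    "(\<forall>i :: nat \<Rightarrow> nat. (\<Prod>r\<in>P. r ^ i r) dvd e \<longrightarrow>
        ord (\<Prod>r\<in>P. r ^ i r) q = Lcm ((\<lambda>r. ord (r ^ i r) q) ` P))
     \<and> (CARD('k) = q \<longrightarrow>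
        (\<forall>(scale :: 'k::field \<Rightarrow> 'v::ab_group_add \<Rightarrow> 'v) \<rho>.
           irreducible_representation G scale \<rho> \<longrightarrow>
           (\<exists>i :: nat \<Rightarrow> nat. (\<Prod>r\<in>P. r ^ i r) dvd e \<and>
              representation_degree scale = Lcm ((\<lambda>r. ord (r ^ i r) q) ` P))))
     \<and> (\<forall>i :: nat \<Rightarrow> nat. (\<Prod>r\<in>P. r ^ i r) dvd e \<longrightarrow>
        (\<forall>r\<in>P. i r \<ge> 1 \<longrightarrow> coprime_part r (ord (r ^ i r) q) = ord r q))"
proof (intro conjI allI impI ballI)
  interpret G: comm_group G by (rule assms(1))
  have order_pos: "Coset.order G > 0"
    using assms(2) G.order_gt_0_iff_finite by blast
  have finP: "finite P"
    unfolding assms(4) using order_pos by (auto intro: finite_subset[OF _ finite_divisors_nat])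
  have ord_prod: "ord (\<Prod>r\<in>P. r ^ i r) q = Lcm ((\<lambda>r. ord (r ^ i r) q) ` P)" for i :: "nat \<Rightarrow> nat"
    using finP by (intro ord_modulus_prod_coprime) (auto simp: assms(4) primes_coprime)
  show "ord (\<Prod>r\<in>P. r ^ i r) q = Lcm ((\<lambda>r. ord (r ^ i r) q) ` P)" for i :: "nat \<Rightarrow> nat"
    by (rule ord_prod)
  show "coprime_part r (ord (r ^ i r) q) = ord r q" if "r \<in> P" "i r \<ge> 1" for i r
  proof (rule coprime_part_ord_prime_power)
    show "coprime q r"
      using that(1) assms(4,6) coprime_divisors[of q q r "Coset.order G"] by simp
  qed (use that assms(4) in auto)
  fix scale :: "'k::field \<Rightarrow> 'v::ab_group_add \<Rightarrow> 'v" and \<rho>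
  assume card: "CARD('k) = q" and irr: "irreducible_representation G scale \<rho>"
  interpret V: irreducible_representation G scale \<rho> by (rule irr)
  obtain v :: 'v where "v \<noteq> 0"
    using V.nonzero by blast
  then interpret V: abelian_irreducible_representation G scale \<rho> v
    by unfold_locales
  obtain d :: nat where d: "d dvd n \<longleftrightarrow> (\<forall>g\<in>carrier G. \<rho> (g [^] n) v = v)" for n
    using V.ex_image_exponent by blast
  have d_e: "d dvd e"
    unfolding d assms(3) using assms(2) by (simp add: G.pow_group_exponent V.rho_one)
  have d_order: "d dvd Coset.order G"
    unfolding d by (simp add: G.pow_order_eq_1 V.rho_one)
  hence "d > 0"
    using order_pos by (intro Nat.gr0I) auto
  have "(\<Prod>r\<in>P. r ^ multiplicity r d) = (\<Prod>r\<in>prime_factors d. r ^ multiplicity r d)"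
  proof (rule prod.mono_neutral_right)
    show "prime_factors d \<subseteq> P"
      using d_order unfolding assms(4) by (auto simp: in_prime_factors_iff intro: dvd_trans)
    show "\<forall>r\<in>P - prime_factors d. r ^ multiplicity r d = 1"
      using \<open>d > 0\<close> by (auto simp: assms(4) in_prime_factors_iff not_dvd_imp_multiplicity_0)
  qed (rule finP)
  also have "\<dots> = d"
    using \<open>d > 0\<close> by (simp add: prime_factorization_nat[symmetric])
  finally have d_prod: "(\<Prod>r\<in>P. r ^ multiplicity r d) = d" .
  have "representation_degree scale = ord d q"
    using assms(2) card assms(5) d by (rule V.representation_degree_eq_ord)
  also have "\<dots> = Lcm ((\<lambda>r. ord (r ^ multiplicity r d) q) ` P)"
    using ord_prod[of "\<lambda>r. multiplicity r d"] by (simp only: d_prod)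
  finally show "\<exists>i :: nat \<Rightarrow> nat. (\<Prod>r\<in>P. r ^ i r) dvd e \<and>
      representation_degree scale = Lcm ((\<lambda>r. ord (r ^ i r) q) ` P)"
    using d_prod d_e by (intro exI[of _ "\<lambda>r. multiplicity r d"]) simp
qed

end
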